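(* Let $n\ge1$, $\varepsilon\in\{+,-\}^{n-1}$, $\pi\in S_n$, and define $$\delta_j=-\varepsilon_{n-j}\quad(1\le j\le n-1),\qquad \pi^{\mathrm{rev}}_j=\pi_{n+1-j}\quad(1\le j\le n).$$ Then $P_\delta$ is the reflection of $P_\varepsilon$ (that is, writing $y_1,\dots,y_n$ for the vertices of $P_\delta$ and $x_1,\dots,x_n$ for those of $P_\varepsilon$, the relabeling $y_j\leftrightarrow x_{n+1-j}$ identifies the two posets), and $$\operatorname{rec}_\varepsilon(\pi)=\operatorname{bl}_{P_\delta}(\pi^{\mathrm{rev}}).$$ More precisely, position $i$ is an $\varepsilon$-record of $\pi$ if and only if the reflected position $n+1-i$ is the root of a block of $(P_\delta,\pi^{\mathrm{rev}})$.
   Context: Fence: for $\varepsilon\in\{+,-\}^{n-1}$, $P_\varepsilon$ is the poset on $\{x_1,\ldots,x_n\}$ obtained as the transitive closure of $x_i\succ x_{i+1}$ if $\varepsilon_i=+$, and $x_i\prec x_{i+1}$ if $\varepsilon_i=-$, $1\le i\le n-1$. Similarly $P_\delta$ on $\{y_1,\dots,y_n\}$. Greedy records: for $\pi\in S_n$, set $i_0=n$; once $i_j$ is chosen, let $A_j(\pi)$ be the set of $i<i_j$ such that $\pi_i>\pi_{i_j}$ if $\varepsilon_i=+$, and $\pi_i<\pi_{i_j}$ if $\varepsilon_i=-$; stop if it is empty, otherwise $i_{j+1}=\max A_j(\pi)$. The positions $i_0>\cdots>i_s$ so obtained are the $\varepsilon$-records of $\pi$, and $\operatorname{rec}_\varepsilon(\pi)=s+1$.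 Kahane's greedy block statistic: given a fence $P_\delta$ with vertices $y_1,\ldots,y_n$ and labels $\sigma_1,\ldots,\sigma_n$ ($\sigma\in S_n$), read from left to right. The first block starts at $y_1$. The root of a block is its leftmost vertex. For $j\ge2$, $y_j$ is an ascent if $y_{j-1}\prec y_j$ ($\delta_{j-1}=-$) and a descent if $y_{j-1}\succ y_j$ ($\delta_{j-1}=+$). When $y_j$ is reached, a new block begins at $y_j$ exactly when $y_j$ is an ascent and $\sigma_j$ is larger than the label of the current block's root, or $y_j$ is a descent and $\sigma_j$ is smaller than the label of the current block's root; otherwise $y_j$ joins the current block. $\operatorname{bl}_{P_\delta}(\sigma)$ is the number of blocks. *)

theory Defs
  imports "HOL-Combinatorics.Permutations"
begin

datatype sign = Plus | Minus

instantiation sign :: uminus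
begin

primrec uminus_sign :: "sign \<Rightarrow> sign" where
  "- Plus = Minus"
| "- Minus = Plus"

instance ..

end

text \<open>
  Vertices $x_1, \ldots, x_n$ are represented by their indices, so that every vertex set is
  \<open>{1..n}\<close>. Sign sequences, permutations and labellings are 1-based functions on \<open>nat\<close>; signs
  are only ever consulted on \<open>{1..n-1}\<close> and labels on \<open>{1..n}\<close>.

  \<open>fence n \<epsilon>\<close> is the strict order of the fence: \<open>(a, b) \<in> fence n \<epsilon>\<close> means $x_a \prec x_b$.
\<close>

definition fence_step :: "nat \<Rightarrow> (nat \<Rightarrow> sign) \<Rightarrow> nat rel" where
  "fence_step n \<epsilon> =
     {(Suc i, i) |i. i \<in> {1..n - 1} \<and> \<epsilon> i = Plus} \<union>
     {(i, Suc i) |i. i \<in> {1..n - 1} \<and> \<epsilon> i = Minus}"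

definition fence :: "nat \<Rightarrow> (nat \<Rightarrow> sign) \<Rightarrow> nat rel" where
  "fence n \<epsilon> = (fence_step n \<epsilon>)\<^sup>+"

definition poset_iso_on ::
    "'a set \<Rightarrow> 'a rel \<Rightarrow> 'b set \<Rightarrow> 'b rel \<Rightarrow> ('a \<Rightarrow> 'b) \<Rightarrow> bool" where
  "poset_iso_on A r B s f \<longleftrightarrow>
     bij_betw f A B \<and> (\<forall>a\<in>A. \<forall>b\<in>A. (a, b) \<in> r \<longleftrightarrow> (f a, f b) \<in> s)"

definition record_candidates :: "(nat \<Rightarrow> sign) \<Rightarrow> (nat \<Rightarrow> nat) \<Rightarrow> nat \<Rightarrow> nat set" where
  "record_candidates \<epsilon> \<pi> k =
     {i. 1 \<le> i \<and> i < k \<and> (case \<epsilon> i of Plus \<Rightarrow> \<pi> i > \<pi> k | Minus \<Rightarrow> \<pi> i < \<pi> k)}"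

lemma finite_record_candidates: "finite (record_candidates \<epsilon> \<pi> k)"
  by (rule finite_subset[of _ "{..<k}"]) (auto simp: record_candidates_def)

lemma Max_record_candidates_less:
  assumes "record_candidates \<epsilon> \<pi> k \<noteq> {}"
  shows "Max (record_candidates \<epsilon> \<pi> k) < k"
  using Max_in[OF finite_record_candidates assms] by (simp add: record_candidates_def)

text \<open>The list $[k = i_j, i_{j+1}, \ldots, i_s]$ of positions chosen from \<open>k\<close> onwards.\<close>

function records_from :: "(nat \<Rightarrow> sign) \<Rightarrow> (nat \<Rightarrow> nat) \<Rightarrow> nat \<Rightarrow> nat list" where
  "records_from \<epsilon> \<pi> k =
     (if record_candidates \<epsilon> \<pi> k = {} then [k]
      else k # records_from \<epsilon> \<pi> (Max (record_candidates \<epsilon> \<pi> k)))"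
  by pat_completeness auto
termination
  by (relation "measure (\<lambda>(_, _, k). k)") (auto simp: Max_record_candidates_less)

declare records_from.simps [simp del]

definition is_record :: "nat \<Rightarrow> (nat \<Rightarrow> sign) \<Rightarrow> (nat \<Rightarrow> nat) \<Rightarrow> nat \<Rightarrow> bool" where
  "is_record n \<epsilon> \<pi> i \<longleftrightarrow> i \<in> set (records_from \<epsilon> \<pi> n)"

definition rec_stat :: "nat \<Rightarrow> (nat \<Rightarrow> sign) \<Rightarrow> (nat \<Rightarrow> nat) \<Rightarrow> nat" where
  "rec_stat n \<epsilon> \<pi> = length (records_from \<epsilon> \<pi> n)"

text \<open>
  In the following, \<open>P\<close> is the strict order of a fence on \<open>{1..n}\<close>.
\<close>

definition ascent :: "nat rel \<Rightarrow> nat \<Rightarrow> bool" where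
  "ascent P j \<longleftrightarrow> (j - 1, j) \<in> P"

definition descent :: "nat rel \<Rightarrow> nat \<Rightarrow> bool" where
  "descent P j \<longleftrightarrow> (j, j - 1) \<in> P"

definition block_root :: "nat set \<Rightarrow> nat" where
  "block_root B = Min B"

definition starts_block :: "nat rel \<Rightarrow> (nat \<Rightarrow> nat) \<Rightarrow> nat set \<Rightarrow> nat \<Rightarrow> bool" where
  "starts_block P \<sigma> B j \<longleftrightarrow>
     (ascent P j \<and> \<sigma> j > \<sigma> (block_root B)) \<or> (descent P j \<and> \<sigma> j < \<sigma> (block_root B))"

text \<open>
  \<open>blocks P \<sigma> m\<close> is the list of blocks after the vertices $y_1, \ldots, y_m$ have been read; its
  last entry is the current block.
\<close>

fun blocks :: "nat rel \<Rightarrow> (nat \<Rightarrow> nat) \<Rightarrow> nat \<Rightarrow> nat set list" where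
  "blocks P \<sigma> 0 = []"
| "blocks P \<sigma> (Suc 0) = [{1}]"
| "blocks P \<sigma> (Suc (Suc m)) =
     (let Bs = blocks P \<sigma> (Suc m); B = last Bs; j = Suc (Suc m)
      in if starts_block P \<sigma> B j then Bs @ [{j}] else butlast Bs @ [insert j B])"

definition is_block_root :: "nat \<Rightarrow> nat rel \<Rightarrow> (nat \<Rightarrow> nat) \<Rightarrow> nat \<Rightarrow> bool" where
  "is_block_root n P \<sigma> k \<longleftrightarrow> (\<exists>B\<in>set (blocks P \<sigma> n). k = block_root B)"

definition bl :: "nat \<Rightarrow> nat rel \<Rightarrow> (nat \<Rightarrow> nat) \<Rightarrow> nat" where
  "bl n P \<sigma> = length (blocks P \<sigma> n)"

text \<open>
  The height function that goes up or down by one at each step of the fence is strictly monotone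
  for \<open>fence n \<epsilon>\<close>. Hence the fence is a strict partial order, and ascents and descents can be read
  off the signs.
\<close>

definition height :: "(nat \<Rightarrow> sign) \<Rightarrow> nat \<Rightarrow> int" where
  "height \<epsilon> k = (\<Sum>i<k. case \<epsilon> i of Plus \<Rightarrow> - 1 | Minus \<Rightarrow> 1)"

lemma height_strict_mono: "(a, b) \<in> fence n \<epsilon> \<Longrightarrow> height \<epsilon> a < height \<epsilon> b"
  unfolding fence_def
  by (induction rule: trancl_induct) (auto simp: fence_step_def height_def)

lemma trans_fence: "trans (fence n \<epsilon>)"
  by (simp add: fence_def)

lemma irrefl_fence: "irrefl (fence n \<epsilon>)"
  using height_strict_mono by (fastforce simp: irrefl_def)

lemma fence_field: "fence n \<epsilon> \<subseteq> {1..n} \<times> {1..n}"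
  unfolding fence_def by (rule trancl_subset_Sigma) (auto simp: fence_step_def)

lemma ascent_fence_iff:
  assumes "2 \<le> j" "j \<le> n"
  shows "ascent (fence n \<delta>) j \<longleftrightarrow> \<delta> (j - 1) = Minus"
proof -
  obtain i where i: "j = Suc i" "i \<in> {1..n - 1}"
    using assms by (cases j) auto
  have "(i, Suc i) \<in> fence n \<delta>" if "\<delta> i = Minus"
    using that i by (auto simp: fence_def fence_step_def)
  moreover have "\<delta> i = Minus" if "(i, Suc i) \<in> fence n \<delta>"
    using height_strict_mono[OF that] by (cases "\<delta> i") (auto simp: height_def)
  ultimately show ?thesis
    using i by (auto simp: ascent_def)
qed

lemma descent_fence_iff:
  assumes "2 \<le> j" "j \<le> n"
  shows "descent (fence n \<delta>) j \<longleftrightarrow> \<delta> (j - 1) = Plus"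
proof -
  obtain i where i: "j = Suc i" "i \<in> {1..n - 1}"
    using assms by (cases j) auto
  have "(Suc i, i) \<in> fence n \<delta>" if "\<delta> i = Plus"
    using that i by (auto simp: fence_def fence_step_def)
  moreover have "\<delta> i = Plus" if "(Suc i, i) \<in> fence n \<delta>"
    using height_strict_mono[OF that] by (cases "\<delta> i") (auto simp: height_def)
  ultimately show ?thesis
    using i by (auto simp: descent_def)
qed

end

theory Submission
  imports Defs
begin

text \<open>
  Both procedures are the same scan. Let \<open>k\<close> be the record chosen last. The next record is the
  first candidate of \<open>k\<close> met when the positions below \<open>k\<close> are read downwards. Under the reflection
  $i \mapsto n + 1 - i$ this is a reading of the vertices of the reflected fence from left to right,
  the record \<open>k\<close> becomes the root of the current block, and the pair $(x_i, x_{i+1})$ becomes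
  $(y_j, y_{j-1})$ with $j = n + 1 - i$. Reversing the direction of reading swaps the two signs, so
  $y_j$ is an ascent exactly when $\varepsilon_i$ is \<open>Plus\<close>, and a descent exactly when it is
  \<open>Minus\<close>. Hence ``\<open>i\<close> is a candidate of \<open>k\<close>'' and ``a new block begins at $y_j$'' are the same
  condition (\<open>reflected_candidate_iff\<close>).

  The greedy choice looks ahead for the largest candidate, while the blocks are built one vertex at a
  time. The invariant that links them (\<open>records_from_scan\<close>) is that the reflected roots
  found so far are an initial part of the list of records, and that no candidate of the last root has
  been passed. Therefore the next candidate found is the largest one, and at the end of the scan the
  two lists coincide.
\<close>

section \<open>Reflection of fences\<close>

lemma uminus_sign_involutive [simp]: "- (- s) = (s :: sign)"
  by (cases s) simp_all

lemma reflect_fence_step: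
  assumes "\<And>j. j \<in> {1..n - 1} \<Longrightarrow> \<delta> j = - \<epsilon> (n - j)"
    and "(a, b) \<in> fence_step n \<delta>"
  shows "(n + 1 - a, n + 1 - b) \<in> fence_step n \<epsilon>"
proof -
  obtain j where j: "j \<in> {1..n - 1}"
    and ab: "(a, b) = (Suc j, j) \<and> \<delta> j = Plus \<or> (a, b) = (j, Suc j) \<and> \<delta> j = Minus"
    using assms(2) by (auto simp: fence_step_def)
  have "\<epsilon> (n - j) = - \<delta> j"
    using assms(1)[OF j] by simp
  moreover have "n - j \<in> {1..n - 1}" "n + 1 - j = Suc (n - j)" "n + 1 - Suc j = n - j"
    using j by auto
  ultimately show ?thesis
    using ab by (auto simp: fence_step_def)
qed

lemma reflect_fence:
  assumes "\<And>j. j \<in> {1..n - 1} \<Longrightarrow> \<delta> j = - \<epsilon> (n - j)"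
    and "(a, b) \<in> fence n \<delta>"
  shows "(n + 1 - a, n + 1 - b) \<in> fence n \<epsilon>"
  using assms(2) unfolding fence_def
proof (induction rule: trancl_induct)
  case (base b)
  then show ?case
    using reflect_fence_step[of n \<delta> \<epsilon>, OF assms(1)] by blast
next
  case (step b c)
  then show ?case
    using reflect_fence_step[of n \<delta> \<epsilon>, OF assms(1)] trancl_into_trancl by metis
qed

lemma poset_iso_on_reflect_fence:
  assumes "\<And>j. j \<in> {1..n - 1} \<Longrightarrow> \<delta> j = - \<epsilon> (n - j)"
  shows "poset_iso_on {1..n} (fence n \<delta>) {1..n} (fence n \<epsilon>) (\<lambda>j. n + 1 - j)"
proof -
  \<comment> \<open>The hypothesis is symmetric in the two sign sequences, and reflection is an involution.\<close>
  have sym: "\<epsilon> j = - \<delta> (n - j)" if "j \<in> {1..n - 1}" for j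
  proof -
    have "n - j \<in> {1..n - 1}" "n - (n - j) = j"
      using that by auto
    then show ?thesis
      using assms[of "n - j"] by simp
  qed
  have "(a, b) \<in> fence n \<delta>"
    if "a \<in> {1..n}" "b \<in> {1..n}" "(n + 1 - a, n + 1 - b) \<in> fence n \<epsilon>" for a b
    using reflect_fence[of n \<epsilon> \<delta>, OF sym that(3)] that(1,2) by simp
  moreover have "bij_betw (\<lambda>j. n + 1 - j) {1..n} {1..n}"
    by (rule bij_betw_byWitness[where f' = "\<lambda>j. n + 1 - j"]) auto
  ultimately show ?thesis
    using reflect_fence[of n \<delta> \<epsilon>, OF assms] by (auto simp: poset_iso_on_def)
qed

section \<open>The roots of the blocks\<close>

definition roots :: "nat rel \<Rightarrow> (nat \<Rightarrow> nat) \<Rightarrow> nat \<Rightarrow> nat list" where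
  "roots P \<sigma> m = map block_root (blocks P \<sigma> m)"

lemma blocks_nonempty: "m \<ge> 1 \<Longrightarrow> blocks P \<sigma> m \<noteq> []"
  by (cases "(P, \<sigma>, m)" rule: blocks.cases) (auto simp: Let_def)

lemma blocks_wellformed:
  "B \<in> set (blocks P \<sigma> m) \<Longrightarrow> B \<noteq> {} \<and> B \<subseteq> {1..m}"
proof (induction P \<sigma> m arbitrary: B rule: blocks.induct)
  case (3 P \<sigma> m)
  let ?Bs = "blocks P \<sigma> (Suc m)"
  have "last ?Bs \<in> set ?Bs"
    by (simp add: blocks_nonempty)
  then have "B \<in> set ?Bs \<or> B = {Suc (Suc m)} \<or> B = insert (Suc (Suc m)) (last ?Bs)"
    using "3.prems" by (auto simp: Let_def split: if_splits dest: in_set_butlastD)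
  then show ?case
    using "3.IH" \<open>last ?Bs \<in> set ?Bs\<close> by fastforce
qed auto

lemma roots_bounds:
  assumes "r \<in> set (roots P \<sigma> m)"
  shows "1 \<le> r" "r \<le> m"
proof -
  obtain B where B: "B \<in> set (blocks P \<sigma> m)" "r = Min B"
    using assms by (auto simp: roots_def block_root_def)
  have "B \<noteq> {}" "B \<subseteq> {1..m}"
    using blocks_wellformed[OF B(1)] by auto
  then have "r \<in> B"
    using B(2) finite_subset by (metis Min_in finite_atLeastAtMost)
  then show "1 \<le> r" "r \<le> m"
    using \<open>B \<subseteq> {1..m}\<close> by auto
qed

text \<open>
  A vertex that joins a block lies to the right of its root, so the root does not change. Thus the
  roots, and not the blocks themselves, determine how the reading continues.
\<close>

lemma roots_Suc:
  assumes "m \<ge> 1"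
  shows "roots P \<sigma> (Suc m) =
    (if ascent P (Suc m) \<and> \<sigma> (Suc m) > \<sigma> (last (roots P \<sigma> m))
      \<or> descent P (Suc m) \<and> \<sigma> (Suc m) < \<sigma> (last (roots P \<sigma> m))
     then roots P \<sigma> m @ [Suc m] else roots P \<sigma> m)"
proof -
  let ?Bs = "blocks P \<sigma> m" and ?j = "Suc m"
  let ?B = "last ?Bs"
  have ne: "?Bs \<noteq> []"
    using assms by (rule blocks_nonempty)
  have Suc: "blocks P \<sigma> ?j =
      (if starts_block P \<sigma> ?B ?j then ?Bs @ [{?j}] else butlast ?Bs @ [insert ?j ?B])"
    using assms by (cases m) (simp_all add: Let_def)
  have last: "last (roots P \<sigma> m) = block_root ?B"
    using ne by (simp add: roots_def last_map)
  have B: "?B \<noteq> {}" "?B \<subseteq> {1..m}" "finite ?B"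
    using blocks_wellformed[of ?B P \<sigma> m] ne by (auto intro: finite_subset)
  have "Min ?B \<le> m"
    using Min_in[OF B(3,1)] B(2) by auto
  then have "block_root (insert ?j ?B) = block_root ?B"
    using B by (simp add: block_root_def)
  then have "map block_root (butlast ?Bs @ [insert ?j ?B]) = roots P \<sigma> m"
    using ne last by (simp add: roots_def map_butlast) (metis append_butlast_last_id map_is_Nil_conv)
  then show ?thesis
    using Suc last by (auto simp: roots_def starts_block_def block_root_def)
qed

section \<open>The scan\<close>

text \<open>
  The step from $y_{j-1}$ to $y_j$ has the sign $\delta_{j-1} = -\varepsilon_i$, where \<open>j = n + 1 - i\<close>.
  It passes from $x_{i+1}$ to $x_i$, against the direction in which $\varepsilon_i$ is read. The
  negation accounts for this change of direction, so that the inequalities between labels agree.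
\<close>

lemma reflected_candidate_iff:
  assumes \<delta>: "\<And>j. j \<in> {1..n - 1} \<Longrightarrow> \<delta> j = - \<epsilon> (n - j)"
    and \<sigma>: "\<And>j. j \<in> {1..n} \<Longrightarrow> \<sigma> j = \<pi> (n + 1 - j)"
    and r: "1 \<le> r" "r < j" "j \<le> n"
  shows "n + 1 - j \<in> record_candidates \<epsilon> \<pi> (n + 1 - r) \<longleftrightarrow>
    ascent (fence n \<delta>) j \<and> \<sigma> j > \<sigma> r \<or> descent (fence n \<delta>) j \<and> \<sigma> j < \<sigma> r"
proof -
  have "\<delta> (j - 1) = - \<epsilon> (n + 1 - j)"
  proof -
    have "j - 1 \<in> {1..n - 1}" "n - (j - 1) = n + 1 - j"
      using r by auto
    then show ?thesis
      using \<delta>[of "j - 1"] by simp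
  qed
  moreover have "\<sigma> j = \<pi> (n + 1 - j)" "\<sigma> r = \<pi> (n + 1 - r)"
    using \<sigma> r by auto
  moreover have "1 \<le> n + 1 - j" "n + 1 - j < n + 1 - r"
    using r by auto
  ultimately show ?thesis
    using r by (cases "\<epsilon> (n + 1 - j)")
      (auto simp: record_candidates_def ascent_fence_iff descent_fence_iff)
qed

text \<open>
  The records still to be found are those that the greedy choice produces from the last root. The
  bound on the candidates is what makes a newly met candidate the greedy one, and it ends the
  recursion when all vertices have been read.
\<close>

lemma records_from_scan:
  assumes \<delta>: "\<And>j. j \<in> {1..n - 1} \<Longrightarrow> \<delta> j = - \<epsilon> (n - j)"
    and \<sigma>: "\<And>j. j \<in> {1..n} \<Longrightarrow> \<sigma> j = \<pi> (n + 1 - j)"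
    and "1 \<le> m" "m \<le> n"
  defines "R \<equiv> roots (fence n \<delta>) \<sigma>"
  shows "records_from \<epsilon> \<pi> n =
      map (\<lambda>r. n + 1 - r) (butlast (R m)) @ records_from \<epsilon> \<pi> (n + 1 - last (R m))
    \<and> (\<forall>i \<in> record_candidates \<epsilon> \<pi> (n + 1 - last (R m)). i \<le> n - m)"
  using assms(3,4)
proof (induction m rule: dec_induct)
  case base
  then show ?case
    by (auto simp: R_def roots_def block_root_def record_candidates_def)
next
  case (step m)
  let ?r = "last (R m)"
  let ?C = "record_candidates \<epsilon> \<pi> (n + 1 - ?r)"
  have ne: "R m \<noteq> []"
    using step.hyps by (simp add: R_def roots_def blocks_nonempty)
  have r: "1 \<le> ?r" "?r \<le> m"
    using roots_bounds[of ?r "fence n \<delta>" \<sigma> m] ne by (auto simp: R_def)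
  have IH: "records_from \<epsilon> \<pi> n =
      map (\<lambda>r. n + 1 - r) (butlast (R m)) @ records_from \<epsilon> \<pi> (n + 1 - ?r)"
    and bound: "\<And>i. i \<in> ?C \<Longrightarrow> i \<le> n - m"
    using step by auto
  have R_Suc: "R (Suc m) = (if n - m \<in> ?C then R m @ [Suc m] else R m)"
    using reflected_candidate_iff[of n \<delta> \<epsilon> \<sigma> \<pi> ?r "Suc m", OF \<delta> \<sigma>] r step.prems step.hyps
    by (simp add: R_def roots_Suc)
  show ?case
  proof (cases "n - m \<in> ?C")
    case True
    have "Max ?C = n - m"
      using True bound finite_record_candidates by (intro Max_eqI) auto
    then have "records_from \<epsilon> \<pi> (n + 1 - ?r) = (n + 1 - ?r) # records_from \<epsilon> \<pi> (n - m)"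
      using True by (subst records_from.simps) auto
    moreover have "map (\<lambda>r. n + 1 - r) (R m) =
        map (\<lambda>r. n + 1 - r) (butlast (R m)) @ [n + 1 - ?r]"
      using ne by (metis append_butlast_last_id list.simps(8,9) map_append)
    ultimately show ?thesis
      using IH True R_Suc by (auto simp: record_candidates_def)
  next
    case False
    have "i \<le> n - Suc m" if "i \<in> ?C" for i
    proof -
      have "i \<noteq> n - m"
        using False that by blast
      then show ?thesis
        using bound[OF that] by linarith
    qed
    then show ?thesis
      using IH False R_Suc by auto
  qed
qed

lemma records_from_eq_reflected_roots:
  assumes \<delta>: "\<And>j. j \<in> {1..n - 1} \<Longrightarrow> \<delta> j = - \<epsilon> (n - j)"
    and \<sigma>: "\<And>j. j \<in> {1..n} \<Longrightarrow> \<sigma> j = \<pi> (n + 1 - j)"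
    and "1 \<le> n"
  shows "records_from \<epsilon> \<pi> n = map (\<lambda>r. n + 1 - r) (roots (fence n \<delta>) \<sigma> n)"
proof -
  let ?R = "roots (fence n \<delta>) \<sigma> n"
  let ?k = "n + 1 - last ?R"
  have scan: "records_from \<epsilon> \<pi> n = map (\<lambda>r. n + 1 - r) (butlast ?R) @ records_from \<epsilon> \<pi> ?k"
    and bound: "\<forall>i \<in> record_candidates \<epsilon> \<pi> ?k. i \<le> 0"
    using records_from_scan[of n \<delta> \<epsilon> \<sigma> \<pi> n, OF \<delta> \<sigma>] assms(3) by auto
  have "record_candidates \<epsilon> \<pi> ?k = {}"
    using bound by (auto simp: record_candidates_def)
  then have "records_from \<epsilon> \<pi> ?k = [?k]"
    by (subst records_from.simps) simp
  moreover have "?R \<noteq> []"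
    using assms(3) by (simp add: roots_def blocks_nonempty)
  ultimately show ?thesis
    using scan by (metis append_butlast_last_id list.simps(8,9) map_append)
qed

theorem proposition2p4:
  fixes n :: nat
    and \<epsilon> \<delta> :: "nat \<Rightarrow> sign"
    and \<pi> \<pi>rev :: "nat \<Rightarrow> nat"
  assumes "n \<ge> 1"
    and "\<pi> permutes {1..n}"
    and "\<And>j. j \<in> {1..n - 1} \<Longrightarrow> \<delta> j = - \<epsilon> (n - j)"
    and "\<And>j. j \<in> {1..n} \<Longrightarrow> \<pi>rev j = \<pi> (n + 1 - j)"
  shows "poset_iso_on {1..n} (fence n \<delta>) {1..n} (fence n \<epsilon>) (\<lambda>j. n + 1 - j)
    \<and> rec_stat n \<epsilon> \<pi> = bl n (fence n \<delta>) \<pi>rev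
    \<and> (\<forall>i\<in>{1..n}. is_record n \<epsilon> \<pi> i \<longleftrightarrow> is_block_root n (fence n \<delta>) \<pi>rev (n + 1 - i))"
proof -
  let ?R = "roots (fence n \<delta>) \<pi>rev n"
  have records: "records_from \<epsilon> \<pi> n = map (\<lambda>r. n + 1 - r) ?R"
    using assms(3,4,1) by (rule records_from_eq_reflected_roots)
  have "is_record n \<epsilon> \<pi> i \<longleftrightarrow> is_block_root n (fence n \<delta>) \<pi>rev (n + 1 - i)"
    if i: "i \<in> {1..n}" for i
  proof -
    have "i = n + 1 - r \<longleftrightarrow> r = n + 1 - i" if "r \<in> set ?R" for r
      using roots_bounds[OF that] i by auto
    then have "i \<in> (\<lambda>r. n + 1 - r) ` set ?R \<longleftrightarrow> n + 1 - i \<in> set ?R"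
      by (auto simp: image_iff)
    then show ?thesis
      by (auto simp: is_record_def is_block_root_def records roots_def)
  qed
  moreover have "rec_stat n \<epsilon> \<pi> = bl n (fence n \<delta>) \<pi>rev"
    by (simp add: rec_stat_def bl_def records roots_def)
  ultimately show ?thesis
    using poset_iso_on_reflect_fence[of n \<delta> \<epsilon>, OF assms(3)] by blast
qed

end
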